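(* Fix an integer $C\geq -1$. There is an effectively computable integer $N_C$ (depending only on $C$) such that the following holds for every $n\geq N_C$. An $n$-element set $A\subset\mathbb R_{>0}$ satisfies $$|\mathrm{FS}(A)|\leq T_n+n+C+1$$ if and only if exactly one of the following alternatives occurs. (1) There are unique $\lambda>0$ and a primitive $B\subset\mathbb Z_{>0}$ such that $A=\lambda B$ and $\sigma(B)\leq T_n+n+C$. (2) There are unique $\lambda>0$, $m\in\{1,2\}$ and $\pi\in\mathcal P(C+m)\cup\mathcal P(C+m+1)$ such that $A=\lambda\,\mathcal E_n(m,\pi)$. Moreover, in the second alternative, if $w=|\pi|$ and $L=\sigma(\mathcal E_n(m,\pi))$, then $L=T_{n+1}-m+w$ and $$\mathrm{FS}(\mathcal E_n(m,\pi))=[0,L]_{\mathbb Z}\setminus\{m,L-m\}.$$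
   Context: For a finite set $A\subset\mathbb R_{>0}$, $\mathrm{FS}(A)=\{\sum_{a\in X}a: X\subseteq A\}$ is its set of subset sums (the empty sum $0$ is included), and $\sigma(A)=\sum_{a\in A}a$. Put $T_n=\binom{n+1}{2}$. For integers $u\le v$, $[u,v]_{\mathbb Z}=\{u,u+1,\dots,v\}$, and it is empty if $u>v$. For $\lambda>0$, $\lambda B=\{\lambda b:b\in B\}$. A finite set $B\subset\mathbb Z_{>0}$ is primitive if $\gcd(B)=1$. For an integer $w$, $\mathcal P(w)$ is the set of weakly increasing positive integer partitions $\pi=(\pi_1,\dots,\pi_\ell)$, $1\le\pi_1\le\cdots\le\pi_\ell$, with $|\pi|:=\sum_{r=1}^{\ell}\pi_r=w$; $\mathcal P(0)=\{()\}$ consists of the empty partition, and $\mathcal P(w)=\varnothing$ for $w<0$. The number of parts is $\ell(\pi)$. For $m\in\{1,2\}$ and a partition $\pi$, $$\mathcal E_n(m,\pi)=\bigl([1,n-\ell(\pi)+1]_{\mathbb Z}\setminus\{m\}\bigr)\cup\{\,n-\ell(\pi)+r+1+\pi_r:1\le r\le\ell(\pi)\,\}.$$ *)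

theory Defs
  imports Complex_Main
begin

definition FS :: "'a::comm_monoid_add set \<Rightarrow> 'a set" where
  "FS A = {\<Sum>X |X. X \<subseteq> A}"

definition T :: "nat \<Rightarrow> int" where
  "T n = int ((n + 1) choose 2)"

definition dilate :: "real \<Rightarrow> int set \<Rightarrow> real set" where
  "dilate l B = (\<lambda>b. l * of_int b) ` B"

definition primitive :: "int set \<Rightarrow> bool" where
  "primitive B \<longleftrightarrow> finite B \<and> B \<subseteq> {0<..} \<and> Gcd B = 1"

text \<open>Weakly increasing partitions. The weight is an arbitrary integer: for \<open>w < 0\<close> the set is
  empty, and \<open>partitions 0\<close> contains only the empty list.\<close>

definition partitions :: "int \<Rightarrow> int list set" where
  "partitions w = {p. sorted p \<and> (\<forall>x\<in>set p. 1 \<le> x) \<and> sum_list p = w}"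

text \<open>Parts are numbered from 1 in the mathematics and from 0 in lists, whence \<open>p ! (r - 1)\<close>.\<close>

definition \<E> :: "nat \<Rightarrow> int \<Rightarrow> int list \<Rightarrow> int set" where
  "\<E> n m p =
     ({1 .. int n - int (length p) + 1} - {m}) \<union>
     {int n - int (length p) + int r + 1 + p ! (r - 1) |r. 1 \<le> r \<and> r \<le> length p}"

text \<open>Total recursive functions of arity \<open>k\<close>, as functions on lists of length \<open>k\<close>; their values on
  lists of other lengths are irrelevant. Minimisation is restricted to regular functions, so that
  every function of the class is total; by Kleene's normal form theorem the class consists of all
  total computable functions.\<close>

inductive recursive :: "nat \<Rightarrow> (nat list \<Rightarrow> nat) \<Rightarrow> bool" where
  zero: "recursive k (\<lambda>_. 0)"
| succ: "recursive 1 (\<lambda>xs. Suc (xs ! 0))"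
| proj: "i < k \<Longrightarrow> recursive k (\<lambda>xs. xs ! i)"
| comp: "recursive (length fs) g \<Longrightarrow> (\<forall>f\<in>set fs. recursive k f) \<Longrightarrow>
     recursive k (\<lambda>xs. g (map (\<lambda>f. f xs) fs))"
| prec: "recursive k f \<Longrightarrow> recursive (k + 2) g \<Longrightarrow>
     recursive (k + 1)
       (\<lambda>xs. rec_nat (f (tl xs)) (\<lambda>i acc. g (i # acc # tl xs)) (hd xs))"
| mini: "recursive (k + 1) f \<Longrightarrow> (\<forall>xs. length xs = k \<longrightarrow> (\<exists>y. f (y # xs) = 0)) \<Longrightarrow>
     recursive k (\<lambda>xs. LEAST y. f (y # xs) = 0)"

definition computable :: "(nat \<Rightarrow> nat) \<Rightarrow> bool" where
  "computable f \<longleftrightarrow> (\<exists>F. recursive 1 F \<and> (\<forall>x. f x = F [x]))"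

end

theory Submission
  imports Defs
begin

text \<open>Let \<open>a\<^sub>1 < \<dots> < a\<^sub>n\<close> be the elements of \<open>A\<close>. Adding \<open>a\<^sub>k\<close> to \<open>X = {a\<^sub>1, \<dots>, a\<^sub>k\<^sub>-\<^sub>1}\<close> creates at
  least one new subset sum for each residue class modulo \<open>a\<^sub>k\<close> met by \<open>FS X\<close>, hence at least \<open>k\<close> of
  them. As the total exceeds \<open>T n + 1\<close> by at most \<open>n + C\<close>, some \<open>k > n / 3\<close> produces at most \<open>k + 1\<close> new
  sums. Then \<open>X\<close> has at most \<open>k + 1\<close> subset sums in the circle \<open>\<real> / a\<^sub>k \<int>\<close>, and a Kneser-type argument shows
  that they form a subgroup. Consequently \<open>{a\<^sub>1, \<dots>, a\<^sub>k}\<close> is a dilate of \<open>{1..k + 1}\<close> minus one point \<open>x\<close>, and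
  its subset sums fill an interval, apart from two symmetric holes when \<open>x \<le> 2\<close>. Each later element
  either preserves this shape or almost doubles the number of subset sums, which is too many.\<close>

section \<open>Subset sums and stabilisers\<close>

lemma finite_FS: "finite A \<Longrightarrow> finite (FS A)"
  unfolding FS_def by (simp add: setcompr_eq_image)

lemma FS_empty [simp]: "FS {} = {0}"
  by (auto simp: FS_def)

lemma FS_I: "X \<subseteq> A \<Longrightarrow> \<Sum>X \<in> FS A"
  by (auto simp: FS_def)

lemma FS_E: "x \<in> FS A \<Longrightarrow> (\<And>X. X \<subseteq> A \<Longrightarrow> x = \<Sum>X \<Longrightarrow> P) \<Longrightarrow> P"
  by (auto simp: FS_def)

lemma zero_in_FS: "0 \<in> FS A"
  using FS_I[of "{}" A] by simp

lemma subset_FS: "A \<subseteq> FS A"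
  using FS_I[of "{a}" A for a] by fastforce

lemma FS_mono: "A \<subseteq> B \<Longrightarrow> FS A \<subseteq> FS B"
  by (auto simp: FS_def)

lemma FS_insert:
  assumes "finite A" "a \<notin> A"
  shows "FS (insert a A) = FS A \<union> (+) a ` FS A"
proof
  show "FS (insert a A) \<subseteq> FS A \<union> (+) a ` FS A"
  proof
    fix s assume "s \<in> FS (insert a A)"
    then obtain X where X: "X \<subseteq> insert a A" "s = \<Sum>X"
      by (rule FS_E)
    show "s \<in> FS A \<union> (+) a ` FS A"
    proof (cases "a \<in> X")
      case True
      have "finite X"
        using X assms(1) finite_subset by blast
      then have "s = a + \<Sum>(X - {a})"
        using True X(2) by (simp add: sum.remove)
      moreover have "\<Sum>(X - {a}) \<in> FS A"
        using X by (intro FS_I) auto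
      ultimately show ?thesis by auto
    next
      case False
      then have "X \<subseteq> A" using X(1) by blast
      then show ?thesis using X(2) FS_I by blast
    qed
  qed
next
  have "a + s \<in> FS (insert a A)" if s: "s \<in> FS A" for s
  proof -
    obtain X where X: "X \<subseteq> A" "s = \<Sum>X"
      using s by (rule FS_E)
    then have "a + s = \<Sum>(insert a X)"
      using assms finite_subset[of X A] by (subst sum.insert) auto
    then show ?thesis
      using X FS_I[of "insert a X" "insert a A"] by auto
  qed
  then show "FS A \<union> (+) a ` FS A \<subseteq> FS (insert a A)"
    using FS_mono[of A "insert a A"] by auto
qed

lemma FS_hom_image:
  fixes h :: "'a::comm_monoid_add \<Rightarrow> 'b::comm_monoid_add"
  assumes h: "\<And>x y. h (x + y) = h x + h y" "h 0 = 0"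
    and "finite A" "inj_on h A"
  shows "FS (h ` A) = h ` FS A"
  using assms(3,4)
proof (induction A rule: finite_induct)
  case empty
  then show ?case by (simp add: h)
next
  case (insert a A)
  then show ?case
    by (auto simp: FS_insert image_Un image_image h inj_on_insert)
qed

lemma FS_split:
  assumes "finite X" "W \<subseteq> X"
  shows "FS X = {u + v |u v. u \<in> FS W \<and> v \<in> FS (X - W)}"
proof
  show "FS X \<subseteq> {u + v |u v. u \<in> FS W \<and> v \<in> FS (X - W)}"
  proof
    fix x assume "x \<in> FS X"
    then obtain Y where Y: "Y \<subseteq> X" "x = \<Sum>Y" by (rule FS_E)
    have "finite Y" using Y(1) assms(1) finite_subset by blast
    then have "x = \<Sum>(Y \<inter> W) + \<Sum>(Y - W)"
      unfolding Y(2) by (rule sum.Int_Diff)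
    then show "x \<in> {u + v |u v. u \<in> FS W \<and> v \<in> FS (X - W)}"
      using Y(1) FS_I[of "Y \<inter> W" W] FS_I[of "Y - W" "X - W"] by blast
  qed
  have "\<Sum>Y + \<Sum>Z \<in> FS X" if "Y \<subseteq> W" "Z \<subseteq> X - W" for Y Z
  proof -
    have fin: "finite Y" "finite Z" using that assms by (meson finite_subset finite_Diff)+
    have "Y \<inter> Z = {}" using that by blast
    then have "\<Sum>Y + \<Sum>Z = \<Sum>(Y \<union> Z)"
      using fin by (simp add: sum.union_disjoint)
    also have "\<dots> \<in> FS X" using that assms by (intro FS_I) auto
    finally show ?thesis .
  qed
  then show "{u + v |u v. u \<in> FS W \<and> v \<in> FS (X - W)} \<subseteq> FS X"
    by (auto elim!: FS_E)
qed

definition stab :: "'a::ab_group_add set \<Rightarrow> 'a set" where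
  "stab S = {g. (+) g ` S \<subseteq> S}"

lemma stab_zero: "0 \<in> stab S"
  by (auto simp: stab_def)

lemma stab_add: "g \<in> stab S \<Longrightarrow> h \<in> stab S \<Longrightarrow> g + h \<in> stab S"
  by (auto simp: stab_def add.assoc image_subset_iff)

lemma stab_uminus:
  assumes "finite S" "g \<in> stab S"
  shows "- g \<in> stab S"
proof -
  have "(+) g ` S = S"
    using assms by (intro card_subset_eq) (auto simp: stab_def card_image)
  then have "(+) (- g) ` (+) g ` S = (+) (- g) ` S" by simp
  then have "(+) (- g) ` S = S" by (simp add: image_image)
  then show ?thesis by (simp add: stab_def)
qed

lemma finite_stab: "finite S \<Longrightarrow> s \<in> S \<Longrightarrow> finite (stab S)"
  by (rule inj_on_finite[where f = "\<lambda>g. g + s"]) (auto simp: stab_def)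

definition sumset :: "'a::ab_group_add set \<Rightarrow> 'a set \<Rightarrow> 'a set" where
  "sumset G S = (\<Union>g\<in>G. (+) g ` S)"

lemma sumset_Un: "sumset G (S \<union> S') = sumset G S \<union> sumset G S'"
  by (auto simp: sumset_def)

lemma sumset_translate: "sumset G ((+) d ` S) = (+) d ` sumset G S"
  by (simp add: sumset_def image_UN image_image add.left_commute)

lemma card_growth_mod_stab:
  fixes X :: "'a::ab_group_add set"
  assumes fin: "finite X" and U: "U \<subseteq> X" and D: "D \<subseteq> X" "D \<inter> U = {}" "D \<inter> G = {}"
    and G: "G = stab (FS X)"
  shows "card (sumset G (FS U)) + card D * card G \<le> card (sumset G (FS (U \<union> D)))"
proof -
  have finG: "finite G"
    unfolding G by (rule finite_stab[OF finite_FS[OF fin] zero_in_FS])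
  have G_add: "g + h \<in> G" if "g \<in> G" "h \<in> G" for g h
    using that stab_add unfolding G by blast
  have G_uminus: "- g \<in> G" if "g \<in> G" for g
    using that stab_uminus[OF finite_FS[OF fin]] unfolding G by blast
  have G_zero: "0 \<in> G" unfolding G by (rule stab_zero)
  have fin_sat: "finite (sumset G S)" if "finite S" for S
    unfolding sumset_def using that finG by blast
  have "finite D" using D(1) fin finite_subset by blast
  then show ?thesis using D
  proof (induction D rule: finite_induct)
    case empty
    then show ?case by simp
  next
    case (insert d D)
    let ?W = "U \<union> D"
    let ?Q = "sumset G (FS ?W)"
    have W: "finite ?W" "?W \<subseteq> X" "d \<notin> ?W" "d \<notin> G" "d \<in> X"
      using insert U fin finite_subset[of U X] by auto
    have Q_G: "g + q \<in> ?Q" if "g \<in> G" "q \<in> ?Q" for g q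
    proof -
      obtain h s where "q = h + s" "h \<in> G" "s \<in> FS ?W"
        using \<open>q \<in> ?Q\<close> by (auto simp: sumset_def)
      then have "g + q = (g + h) + s" "g + h \<in> G"
        using G_add[OF \<open>g \<in> G\<close> \<open>h \<in> G\<close>] by (simp_all add: add.assoc)
      then show ?thesis
        using \<open>s \<in> FS ?W\<close> unfolding sumset_def by blast
    qed
    have sat_ins: "sumset G (FS (insert d ?W)) = ?Q \<union> (+) d ` ?Q"
      by (simp add: FS_insert[OF W(1,3)] sumset_Un sumset_translate)
    have "\<exists>q\<in>?Q. d + q \<notin> ?Q"
    proof (rule ccontr)
      assume "\<not> ?thesis"
      then have dQ: "d + q \<in> ?Q" if "q \<in> ?Q" for q using that by blast
      have "d \<in> stab (FS X)"
        unfolding stab_def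
      proof (clarify)
        fix s assume "s \<in> FS X"
        have ext: "FS X = {u + v |u v. u \<in> FS ?W \<and> v \<in> FS (X - ?W)}"
          by (rule FS_split[OF fin W(2)])
        obtain u v where uv: "s = u + v" "u \<in> FS ?W" "v \<in> FS (X - ?W)"
          using \<open>s \<in> FS X\<close> ext by blast
        have "u \<in> ?Q"
          using uv(2) G_zero unfolding sumset_def by force
        from dQ[OF this] obtain g t where gt: "d + u = g + t" "g \<in> G" "t \<in> FS ?W"
          unfolding sumset_def by blast
        have "t + v \<in> FS X" using ext gt uv by blast
        then have "g + (t + v) \<in> FS X" using gt(2) unfolding G stab_def by blast
        moreover have "d + s = g + (t + v)" using gt(1) uv(1) by (metis add.assoc)
        ultimately show "d + s \<in> FS X" by simp
      qed
      then show False using W(4) G by blast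
    qed
    then obtain q where q: "q \<in> ?Q" "d + q \<notin> ?Q" by blast
    let ?N = "(\<lambda>g. d + (g + q)) ` G"
    have "?N \<inter> ?Q = {}"
    proof -
      have False if "g \<in> G" "d + (g + q) \<in> ?Q" for g
        using Q_G[OF G_uminus[OF that(1)] that(2)] q(2) by (simp add: algebra_simps)
      then show ?thesis by blast
    qed
    moreover have "?Q \<union> ?N \<subseteq> sumset G (FS (insert d ?W))"
      unfolding sat_ins using Q_G q(1) by auto
    moreover have "card ?N = card G"
      by (intro card_image inj_onI) simp
    moreover have "finite (sumset G (FS (insert d ?W)))" "finite ?Q"
      using W(1) by (auto intro!: fin_sat finite_FS)
    moreover have "finite ?N" using finG by simp
    ultimately have "card ?Q + card G \<le> card (sumset G (FS (insert d ?W)))"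
      using card_mono[of "sumset G (FS (insert d ?W))" "?Q \<union> ?N"] card_Un_disjoint[of ?Q ?N]
      by (simp add: inf_commute)
    moreover have "card (sumset G (FS U)) + card D * card G \<le> card ?Q"
      using insert by simp
    ultimately show ?case using insert by simp
  qed
qed

text \<open>A subset-sum set barely larger than its ground set must be a subgroup: otherwise its
  stabiliser \<open>G\<close> is proper, and every element outside \<open>G\<close> contributes a whole coset of \<open>G\<close>.\<close>

lemma small_FS_imp_stab:
  fixes X :: "'a::ab_group_add set"
  assumes fin: "finite X" and "0 \<notin> X" and card: "card X \<ge> 3" "card (FS X) \<le> card X + 2"
    and U: "U \<subseteq> X" "card (FS U) \<ge> card U + 3"
  shows "X \<subseteq> stab (FS X)"
proof (rule ccontr)
  assume nsub: "\<not> X \<subseteq> stab (FS X)"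
  define G where "G = stab (FS X)"
  define W where "W = X - G"
  have finG: "finite G"
    unfolding G_def by (rule finite_stab[OF finite_FS[OF fin] zero_in_FS])
  have G0: "0 \<in> G" unfolding G_def by (rule stab_zero)
  have sat_le: "card (sumset G (FS V)) \<le> card (FS X)" if "V \<subseteq> X" for V
    using FS_mono[OF that] by (intro card_mono finite_FS fin) (auto simp: sumset_def G_def stab_def)
  have "finite W" using fin by (simp add: W_def)
  have W: "card W \<ge> 1"
    using nsub \<open>finite W\<close> by (auto simp: W_def G_def Suc_le_eq card_gt_0_iff)
  have "card X = card (X \<inter> G) + card W"
    unfolding W_def using fin by (metis card_Int_Diff)
  moreover have "card (X \<inter> G) \<le> card (G - {0})"
    using assms(2) finG by (intro card_mono) auto
  moreover have cG: "Suc (card (G - {0})) = card G"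
    using finG G0 by (rule card_Suc_Diff1)
  ultimately have cX: "card X + 1 \<le> card W + card G"
    by linarith
  show False
  proof (cases "card G = 1")
    case True
    then have G: "G = {0}" using G0 by (metis card_1_singletonE singletonD)
    have sumset: "sumset G S = S" for S by (auto simp: sumset_def G)
    have "card (FS U) + card (X - U) \<le> card (FS (U \<union> (X - U)))"
      using card_growth_mod_stab[OF fin U(1) Diff_subset _ _ G_def, of U] assms(2)
      unfolding sumset True by (simp add: G Int_commute)
    moreover have "card X = card U + card (X - U)"
      using fin U(1) by (metis card_Diff_subset card_mono finite_subset le_add_diff_inverse)
    moreover have "U \<union> (X - U) = X" using U(1) by blast
    ultimately show False using U(2) card by simp
  next
    case False
    then have "card G \<ge> 2"
      using cG False by linarith
    have "card (sumset G (FS {})) + card W * card G \<le> card (sumset G (FS ({} \<union> W)))"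
      by (intro card_growth_mod_stab[OF fin _ _ _ _ G_def]) (auto simp: W_def)
    also have "\<dots> \<le> card X + 2"
      using sat_le[of W] card by (simp add: W_def)
    finally have "card G + card W * card G \<le> card X + 2"
      by (simp add: sumset_def)
    moreover have "card W * 2 \<le> card W * card G"
      using \<open>card G \<ge> 2\<close> by simp
    ultimately have "card W = 1" using cX W by linarith
    then show False
      using \<open>card G + card W * card G \<le> card X + 2\<close> cX card(1) by simp
  qed
qed

lemma sum_const_stab:
  fixes S :: "'a::ab_group_add set"
  assumes "finite S" "g \<in> stab S"
  shows "(\<Sum>s\<in>S. g) = 0"
proof -
  have "(+) g ` S = S"
    using assms by (intro card_subset_eq) (auto simp: stab_def card_image)
  then have "(\<Sum>s\<in>S. s) = (\<Sum>s\<in>S. g + s)"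
    by (metis (mono_tags, lifting) add_left_cancel inj_onI sum.reindex_cong)
  then show ?thesis by (simp add: sum.distrib)
qed

section \<open>The circle\<close>

quotient_type circle = real / "\<lambda>x y :: real. x - y \<in> \<int>"
proof (rule equivpI)
  show "reflp (\<lambda>x y :: real. x - y \<in> \<int>)"
    by (rule reflpI) simp
  show "symp (\<lambda>x y :: real. x - y \<in> \<int>)"
    by (rule sympI) (metis Ints_minus minus_diff_eq)
  show "transp (\<lambda>x y :: real. x - y \<in> \<int>)"
    by (rule transpI) (metis Ints_add diff_add_cancel add_diff_eq)
qed

instantiation circle :: ab_group_add
begin

lift_definition zero_circle :: circle is "0 :: real" .

lift_definition plus_circle :: "circle \<Rightarrow> circle \<Rightarrow> circle" is "(+) :: real \<Rightarrow> real \<Rightarrow> real"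
  by (metis Ints_add add_diff_add)

lift_definition minus_circle :: "circle \<Rightarrow> circle \<Rightarrow> circle" is "(-) :: real \<Rightarrow> real \<Rightarrow> real"
  by (metis Ints_diff diff_diff_eq2 diff_add_eq add.commute diff_diff_add)

lift_definition uminus_circle :: "circle \<Rightarrow> circle" is "uminus :: real \<Rightarrow> real"
  by (metis Ints_minus minus_diff_eq minus_diff_minus)

instance
  by standard (transfer; simp add: algebra_simps)+

end

lift_definition circ :: "real \<Rightarrow> circle" is "\<lambda>x. x" .

lemma circ_add: "circ (x + y) = circ x + circ y"
  by transfer simp

lemma circ_zero: "circ 0 = 0"
  by transfer simp

lemma circ_eq_iff: "circ x = circ y \<longleftrightarrow> x - y \<in> \<int>"
  by transfer simp

lemma circ_of_int: "circ (of_int k) = 0"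
  unfolding circ_zero[symmetric] circ_eq_iff by simp

lemma circ_sum_const: "(\<Sum>s\<in>S. circ x) = circ (of_nat (card S) * x)"
  by (induction S rule: infinite_finite_induct)
    (simp_all add: circ_zero circ_add[symmetric] distrib_right)

lemma Ints_abs_less_1: "x \<in> \<int> \<Longrightarrow> \<bar>x\<bar> < 1 \<Longrightarrow> x = (0::real)"
  by (auto elim!: Ints_cases)

lemma inj_on_circ:
  assumes "\<And>x y. x \<in> S \<Longrightarrow> y \<in> S \<Longrightarrow> x - y < 1"
  shows "inj_on circ S"
proof (rule inj_onI)
  fix x y assume "x \<in> S" "y \<in> S" "circ x = circ y"
  then have "x - y \<in> \<int>" "\<bar>x - y\<bar> < 1"
    using assms[of x y] assms[of y x] by (auto simp: circ_eq_iff)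
  then show "x = y" using Ints_abs_less_1 by fastforce
qed

lemma inj_on_circ_unit:
  assumes "\<And>x. x \<in> S \<Longrightarrow> 0 < x \<and> x < 1"
  shows "inj_on circ S"
proof (rule inj_on_circ)
  fix x y assume "x \<in> S" "y \<in> S"
  then show "x - y < 1" using assms[of x] assms[of y] by simp
qed

lemma card_restricted_sums:
  fixes U :: "real set"
  assumes fin: "finite U" and card: "card U \<ge> 2"
  shows "card {x + y |x y. x \<in> U \<and> y \<in> U \<and> x \<noteq> y} + 3 \<ge> 2 * card U"
proof -
  let ?S = "{x + y |x y. x \<in> U \<and> y \<in> U \<and> x \<noteq> y}"
  define a b where "a = Min U" and "b = Max U"
  have ne: "U \<noteq> {}" using card by auto
  have ab: "a \<in> U" "b \<in> U" "\<And>x. x \<in> U \<Longrightarrow> a \<le> x \<and> x \<le> b"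
    using fin ne by (auto simp: a_def b_def)
  have "a \<noteq> b"
  proof
    assume "a = b"
    then have "U \<subseteq> {a}" using ab(3) by force
    then show False using card card_mono[of "{a}" U] by simp
  qed
  let ?L = "(+) a ` (U - {a})" and ?R = "(+) b ` (U - {a, b})"
  have "finite ?S"
    by (rule finite_subset[of _ "(\<lambda>(x, y). x + y) ` (U \<times> U)"]) (use fin in auto)
  moreover have "?L \<union> ?R \<subseteq> ?S" using ab by blast
  ultimately have "card (?L \<union> ?R) \<le> card ?S" by (rule card_mono)
  moreover have "?L \<inter> ?R = {}"
  proof -
    have False if "a + x = b + y" "x \<in> U" "y \<in> U" "y \<noteq> a" for x y
      using that ab(3)[of x] ab(3)[of y] by simp
    then show ?thesis by blast
  qed
  then have "card (?L \<union> ?R) = card (U - {a}) + card (U - {a, b})"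
    using fin by (simp add: card_Un_disjoint card_image)
  moreover have "card (U - {a}) = card U - 1" "card (U - {a, b}) = card U - 2"
    using ab \<open>a \<noteq> b\<close> fin by (simp_all add: card_Diff_subset)
  ultimately show ?thesis using card by linarith
qed

text \<open>Two-element sums of points in a half circle do not wrap around.\<close>

lemma card_FS_half_circle:
  fixes U :: "real set"
  assumes fin: "finite U" and card: "card U \<ge> 6"
    and half: "\<And>x y. x \<in> U \<Longrightarrow> y \<in> U \<Longrightarrow> x - y < 1 / 2"
  shows "card (FS (circ ` U)) \<ge> card (circ ` U) + 3"
proof -
  let ?S = "{x + y |x y. x \<in> U \<and> y \<in> U \<and> x \<noteq> y}"
  have inj: "inj_on circ U" using half by (intro inj_on_circ) force
  have "FS (circ ` U) = circ ` FS U"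
    using fin inj by (intro FS_hom_image) (auto simp: circ_add circ_zero)
  moreover have "?S \<subseteq> FS U"
  proof clarify
    fix x y assume "x \<in> U" "y \<in> U" "x \<noteq> y"
    then show "x + y \<in> FS U" using FS_I[of "{x, y}" U] by simp
  qed
  ultimately have "card (circ ` ?S) \<le> card (FS (circ ` U))"
    using finite_FS[OF fin] by (auto intro!: card_mono image_mono)
  moreover have "inj_on circ ?S"
  proof (rule inj_on_circ)
    fix s t assume "s \<in> ?S" "t \<in> ?S"
    then obtain x y x' y' where "s = x + y" "t = x' + y'" "x \<in> U" "y \<in> U" "x' \<in> U" "y' \<in> U"
      by blast
    then show "s - t < 1" using half[of x x'] half[of y y'] by simp
  qed
  then have "card (circ ` ?S) = card ?S" by (rule card_image)
  ultimately show ?thesis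
    using card_restricted_sums[OF fin] card card_image[OF inj] by linarith
qed

lemma residues_le_new_sums:
  fixes X :: "real set"
  assumes fin: "finite X" and X: "\<And>x. x \<in> X \<Longrightarrow> 0 < x \<and> x < 1"
  shows "card (FS X) + card (FS (circ ` X)) \<le> card (FS (insert 1 X))"
proof -
  let ?F = "FS X"
  let ?N = "(+) 1 ` ?F - ?F"
  have finF: "finite ?F" using fin by (rule finite_FS)
  have "inj_on circ X" using X by (rule inj_on_circ_unit)
  then have "FS (circ ` X) = circ ` ?F"
    using fin by (intro FS_hom_image) (auto simp: circ_add circ_zero)
  also have "\<dots> \<subseteq> circ ` ?N"
  proof
    fix c assume "c \<in> circ ` ?F"
    define M where "M = Max {y \<in> ?F. circ y = c}"
    have "{y \<in> ?F. circ y = c} \<noteq> {}" using \<open>c \<in> circ ` ?F\<close> by auto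
    then have "M \<in> {y \<in> ?F. circ y = c}"
      unfolding M_def using finF by (intro Max_in) auto
    then have M: "M \<in> ?F" "circ M = c" by auto
    have circ1: "circ (1 + M) = c"
      using M circ_of_int[of 1] by (simp add: circ_add)
    have "1 + M \<notin> ?F"
    proof
      assume "1 + M \<in> ?F"
      then have "1 + M \<le> M" unfolding M_def using finF circ1 by (intro Max_ge) (auto simp: M_def)
      then show False by simp
    qed
    then show "c \<in> circ ` ?N" using M(1) circ1 by (metis DiffI imageI)
  qed
  finally have "card (FS (circ ` X)) \<le> card (circ ` ?N)"
    using finF by (intro card_mono) auto
  also have "\<dots> \<le> card ?N" using finF by (intro card_image_le) auto
  finally have "card ?F + card (FS (circ ` X)) \<le> card ?F + card ?N" by simp
  also have "\<dots> = card (?F \<union> ?N)"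
    using finF by (subst card_Un_disjoint) auto
  also have "?F \<union> ?N = FS (insert 1 X)"
    using X by (subst FS_insert[OF fin]) force+
  finally show ?thesis .
qed

lemma card_circ_FS_ge:
  fixes X :: "real set"
  assumes fin: "finite X" and X: "\<And>x. x \<in> X \<Longrightarrow> 0 < x \<and> x < 1"
  shows "card X + 1 \<le> card (FS (circ ` X))" "0 \<notin> circ ` X" "card (circ ` X) = card X"
proof -
  have "inj_on circ X" using X by (rule inj_on_circ_unit)
  then show c: "card (circ ` X) = card X" by (rule card_image)
  show n: "0 \<notin> circ ` X"
  proof
    assume "0 \<in> circ ` X"
    then obtain x where "x \<in> X" "circ x = circ 0" by (auto simp: circ_zero)
    then show False using X[of x] Ints_abs_less_1[of x] by (auto simp: circ_eq_iff)
  qed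
  have "card (insert 0 (circ ` X)) \<le> card (FS (circ ` X))"
    using fin subset_FS[of "circ ` X"] zero_in_FS[of "circ ` X"]
    by (intro card_mono finite_FS) auto
  then show "card X + 1 \<le> card (FS (circ ` X))" using n fin c by simp
qed

lemma small_growth_unit_structure:
  fixes X :: "real set"
  assumes fin: "finite X" and X: "\<And>x. x \<in> X \<Longrightarrow> 0 < x \<and> x < 1"
    and card: "card X \<ge> 11"
    and growth: "card (FS (insert 1 X)) \<le> card (FS X) + card X + 2"
  obtains r where "card X + 1 \<le> r" "r \<le> card X + 2" "\<And>x. x \<in> X \<Longrightarrow> of_nat r * x \<in> \<int>"
proof -
  let ?Y = "circ ` X"
  let ?H = "FS ?Y"
  note Y = card_circ_FS_ge[OF fin X]
  have finY: "finite ?Y" using fin by simp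
  have H: "card ?H \<le> card X + 2"
    using residues_le_new_sums[OF fin X] growth by linarith
  have "\<exists>U\<subseteq>?Y. card (FS U) \<ge> card U + 3"
  proof -
    define V where "V = {x \<in> X. x < 1 / 2}"
    have "card X = card (X \<inter> V) + card (X - V)"
      using fin by (rule card_Int_Diff)
    then have "card (X \<inter> V) \<ge> 6 \<or> card (X - V) \<ge> 6" using card by linarith
    then show ?thesis
    proof
      assume "card (X \<inter> V) \<ge> 6"
      then have "card (FS (circ ` (X \<inter> V))) \<ge> card (circ ` (X \<inter> V)) + 3"
        using fin X by (intro card_FS_half_circle) (force simp: V_def)+
      then show ?thesis by (meson Int_lower1 image_mono)
    next
      assume "card (X - V) \<ge> 6"
      then have "card (FS (circ ` (X - V))) \<ge> card (circ ` (X - V)) + 3"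
        using fin X by (intro card_FS_half_circle) (force simp: V_def)+
      then show ?thesis by (meson Diff_subset image_mono)
    qed
  qed
  then obtain U where "U \<subseteq> ?Y" "card (FS U) \<ge> card U + 3" by blast
  then have stab: "?Y \<subseteq> stab ?H"
    using finY Y H card by (intro small_FS_imp_stab) auto
  have "of_nat (card ?H) * x \<in> \<int>" if "x \<in> X" for x
  proof -
    have "circ x \<in> stab ?H" using stab that by blast
    then have "(\<Sum>s\<in>?H. circ x) = 0"
      using finite_FS[OF finY] by (rule sum_const_stab[rotated])
    then have "circ (of_nat (card ?H) * x) = circ 0"
      by (simp add: circ_sum_const circ_zero)
    then show ?thesis by (simp add: circ_eq_iff)
  qed
  then show thesis using Y(1) H that by blast
qed

lemma FS_scale:
  fixes X :: "real set"
  assumes "finite X" "c \<noteq> 0"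
  shows "FS ((*) c ` X) = (*) c ` FS X"
  using assms by (intro FS_hom_image) (auto simp: algebra_simps inj_on_def)

lemma card_FS_scale:
  fixes X :: "real set"
  assumes "finite X" "c \<noteq> 0"
  shows "card (FS ((*) c ` X)) = card (FS X)"
  using assms by (simp add: FS_scale card_image inj_on_def)

lemma new_sums_ge:
  fixes X :: "real set"
  assumes fin: "finite X" and X: "\<And>x. x \<in> X \<Longrightarrow> 0 < x \<and> x < a"
    and a: "a > 0"
  shows "card (FS X) + card X + 1 \<le> card (FS (insert a X))"
proof -
  let ?X = "(*) (1 / a) ` X"
  have X': "\<And>x. x \<in> ?X \<Longrightarrow> 0 < x \<and> x < 1" using X a by auto
  have fin': "finite ?X" using fin by simp
  have "insert 1 ?X = (*) (1 / a) ` insert a X" using a by simp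
  then have "card (FS (insert 1 ?X)) = card (FS ((*) (1 / a) ` insert a X))" by metis
  also have "\<dots> = card (FS (insert a X))"
    using a fin by (intro card_FS_scale) auto
  finally have "card (FS (insert 1 ?X)) = card (FS (insert a X))" .
  moreover have "card (FS ?X) = card (FS X)" using a fin by (intro card_FS_scale) auto
  moreover have "card ?X = card X" using a by (simp add: card_image inj_on_def)
  ultimately show ?thesis
    using residues_le_new_sums[OF fin' X'] card_circ_FS_ge(1)[OF fin' X'] by simp
qed

lemma small_growth_structure:
  fixes X :: "real set"
  assumes fin: "finite X" and X: "\<And>x. x \<in> X \<Longrightarrow> 0 < x \<and> x < a"
    and a: "a > 0" and card: "card X \<ge> 11"
    and growth: "card (FS (insert a X)) \<le> card (FS X) + card X + 2"
  obtains l B where "l > 0" "B \<subseteq> {1..int (card X) + 2}" "insert a X = dilate l B"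
proof -
  let ?X = "(*) (1 / a) ` X"
  have X': "\<And>x. x \<in> ?X \<Longrightarrow> 0 < x \<and> x < 1" using X a by auto
  have fin': "finite ?X" using fin by simp
  have "insert 1 ?X = (*) (1 / a) ` insert a X" using a by simp
  then have "card (FS (insert 1 ?X)) = card (FS ((*) (1 / a) ` insert a X))" by metis
  also have "\<dots> = card (FS (insert a X))"
    using a fin by (intro card_FS_scale) auto
  finally have "card (FS (insert 1 ?X)) = card (FS (insert a X))" .
  moreover have "card (FS ?X) = card (FS X)" using a fin by (intro card_FS_scale) auto
  moreover have cX: "card ?X = card X" using a by (simp add: card_image inj_on_def)
  ultimately have "card (FS (insert 1 ?X)) \<le> card (FS ?X) + card ?X + 2"
    using growth by simp
  moreover have "card ?X \<ge> 11" using cX card by simp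
  ultimately obtain r where r: "card X + 1 \<le> r" "r \<le> card X + 2"
    "\<And>x. x \<in> ?X \<Longrightarrow> of_nat r * x \<in> \<int>"
    using small_growth_unit_structure[OF fin' X'] cX by metis
  define l where "l = a / r"
  have r0: "real r > 0" using r(1) by simp
  have l: "l > 0" using a r0 by (simp add: l_def)
  have "\<exists>b\<in>{1..int r}. x = l * of_int b" if "x \<in> insert a X" for x
  proof -
    have "real r * (1 / a * x) \<in> \<int>"
    proof (cases "x = a")
      case True
      then show ?thesis using a by simp
    next
      case False
      then show ?thesis using that by (intro r(3) imageI) simp
    qed
    then obtain b where b: "real r * (1 / a * x) = of_int b" by (auto elim: Ints_cases)
    have "0 < x" "x \<le> a" using that X[of x] a by auto
    have "x = l * of_int b" unfolding b[symmetric] l_def using a r0 by simp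
    moreover have "0 < real_of_int b"
      unfolding b[symmetric] using \<open>0 < x\<close> a r0 by simp
    moreover have "real_of_int b \<le> real r"
      unfolding b[symmetric] using \<open>x \<le> a\<close> a r0 by (simp add: field_simps)
    ultimately show ?thesis by (intro bexI[of _ b]) auto
  qed
  then have "insert a X = dilate l {b \<in> {1..int r}. l * of_int b \<in> insert a X}"
    unfolding dilate_def by blast
  moreover have "{b \<in> {1..int r}. l * of_int b \<in> insert a X} \<subseteq> {1..int (card X) + 2}"
    using r by auto
  ultimately show thesis using that l by blast
qed

section \<open>Intervals with two symmetric holes\<close>

lemma T_Suc: "T (Suc n) = T n + int n + 1"
  by (simp add: T_def numeral_2_eq_2)

lemma two_T: "2 * T n = int n * (int n + 1)"
proof (induction n)
  case 0
  then show ?case by (simp add: T_def)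
next
  case (Suc n)
  then show ?case by (simp add: T_Suc algebra_simps)
qed

lemma T_ge_mult: "2 * j \<le> int n + 1 \<Longrightarrow> int n * j \<le> T n"
proof -
  assume "2 * j \<le> int n + 1"
  then have "int n * (2 * j) \<le> int n * (int n + 1)" by (intro mult_left_mono) auto
  then show ?thesis using two_T[of n] by simp
qed

lemma sum_interval: "\<Sum>{1..int n} = T n"
proof (induction n)
  case 0
  then show ?case by (simp add: T_def)
next
  case (Suc n)
  have "{1..int (Suc n)} = insert (int n + 1) {1..int n}" by auto
  then show ?case using Suc by (simp add: T_Suc)
qed

lemma sum_interval_minus:
  assumes "1 \<le> x" "x \<le> int n"
  shows "\<Sum>({1..int n} - {x}) = T n - x"
  using assms sum_interval[of n] by (simp add: sum_diff1)

lemma sum_interval_minus_ge: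
  assumes "1 \<le> x"
  shows "\<Sum>({1..int n} - {x}) \<ge> T n - int n"
proof (cases "x \<le> int n")
  case True
  then show ?thesis using assms by (simp add: sum_interval_minus)
next
  case False
  then show ?thesis using sum_interval[of n] by simp
qed

text \<open>The value \<open>m = -1\<close> encodes the absence of holes, because \<open>-1\<close> and \<open>\<Sum>B + 1\<close> lie outside
  the interval.\<close>

definition hole :: "int \<Rightarrow> int set \<Rightarrow> bool" where
  "hole m B \<longleftrightarrow> finite B \<and> B \<subseteq> {0<..} \<and> FS B = {0..\<Sum>B} - {m, \<Sum>B - m}"

lemma hole_insert:
  assumes B: "hole m B" and m: "-1 \<le> m"
    and b: "b \<notin> B" "0 < b" "m < b" "b + m \<le> \<Sum>B" "b + 2 * m \<noteq> \<Sum>B"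
  shows "hole m (insert b B)"
proof -
  define S where "S = \<Sum>B"
  have fin: "finite B" and FS: "FS B = {0..S} - {m, S - m}"
    using B by (auto simp: hole_def S_def)
  have "(+) b ` ({0..S} - {m, S - m}) = {b..b + S} - {b + m, b + S - m}"
    by (simp add: image_set_diff algebra_simps)
  then have "FS (insert b B) = ({0..S} - {m, S - m}) \<union> ({b..b + S} - {b + m, b + S - m})"
    using fin b(1) FS by (simp add: FS_insert)
  also have "\<dots> = {0..b + S} - {m, b + S - m}"
  proof (rule set_eqI, simp only: Un_iff Diff_iff atLeastAtMost_iff insert_iff empty_iff)
    fix x
    show "(0 \<le> x \<and> x \<le> S) \<and> \<not> (x = m \<or> x = S - m \<or> False) \<or>
        (b \<le> x \<and> x \<le> b + S) \<and> \<not> (x = b + m \<or> x = b + S - m \<or> False) \<longleftrightarrow>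
        (0 \<le> x \<and> x \<le> b + S) \<and> \<not> (x = m \<or> x = b + S - m \<or> False)"
      using m b(2-5) unfolding S_def[symmetric] by linarith
  qed
  finally show ?thesis
    using B b fin by (auto simp: hole_def S_def)
qed

lemma hole_union:
  assumes B: "hole m B" and m: "-1 \<le> m" and D: "finite D" "D \<inter> B = {}"
    and bound: "\<And>d. d \<in> D \<Longrightarrow> 0 < d \<and> m < d \<and> d + 2 * m < \<Sum>B"
  shows "hole m (B \<union> D)"
  using D bound
proof (induction D rule: finite_induct)
  case empty
  then show ?case using B by simp
next
  case (insert d D)
  have fin: "finite B" using B by (simp add: hole_def)
  have "\<Sum>B \<le> \<Sum>(B \<union> D)"
  proof (rule sum_mono2)
    fix x assume "x \<in> B \<union> D - B"
    then show "0 \<le> x" using insert.prems(2)[of x] by auto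
  qed (use fin insert in auto)
  moreover have "0 < d" "m < d" "d + 2 * m < \<Sum>B" using insert.prems(2)[of d] by auto
  ultimately have "d + m \<le> \<Sum>(B \<union> D)" "d + 2 * m < \<Sum>(B \<union> D)" "0 < d" "m < d"
    using m by linarith+
  then have "hole m (insert d (B \<union> D))"
    using insert m by (intro hole_insert) auto
  then show ?case by simp
qed

lemma hole_interval_minus:
  assumes "1 \<le> x" "4 \<le> k"
  shows "hole (if x \<le> 2 then x else -1) ({1..int k} - {x})"
  using assms(2)
proof (induction k rule: dec_induct)
  case base
  have four: "{1..int 4} = {1, 2, 3, 4}" by auto
  consider "x = 1" | "x = 2" | "x = 3" | "x = 4" | "x \<ge> 5" using assms(1) by linarith
  then show ?case
  proof cases
    case 1
    have "{1..int 4} - {x} = {2, 3, 4}" unfolding four 1 by auto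
    moreover have "FS {2, 3, 4 :: int} = {0..9} - {1, 8}"
      by (simp add: FS_insert, rule set_eqI,
          simp only: Diff_iff atLeastAtMost_iff insert_iff empty_iff, presburger)
    ultimately show ?thesis using 1 by (simp add: hole_def)
  next
    case 2
    have "{1..int 4} - {x} = {1, 3, 4}" unfolding four 2 by auto
    moreover have "FS {1, 3, 4 :: int} = {0..8} - {2, 6}"
      by (simp add: FS_insert, rule set_eqI,
          simp only: Diff_iff atLeastAtMost_iff insert_iff empty_iff, presburger)
    ultimately show ?thesis using 2 by (simp add: hole_def)
  next
    case 3
    have "{1..int 4} - {x} = {1, 2, 4}" unfolding four 3 by auto
    moreover have "FS {1, 2, 4 :: int} = {0..7} - {-1, 8}"
      by (simp add: FS_insert, rule set_eqI,
          simp only: Diff_iff atLeastAtMost_iff insert_iff empty_iff, presburger)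
    ultimately show ?thesis using 3 by (simp add: hole_def)
  next
    case 4
    have "{1..int 4} - {x} = {1, 2, 3}" unfolding four 4 by auto
    moreover have "FS {1, 2, 3 :: int} = {0..6} - {-1, 7}"
      by (simp add: FS_insert, rule set_eqI,
          simp only: Diff_iff atLeastAtMost_iff insert_iff empty_iff, presburger)
    ultimately show ?thesis using 4 by (simp add: hole_def)
  next
    case 5
    then have "{1..int 4} - {x} = {1, 2, 3, 4}" unfolding four by auto
    moreover have "FS {1, 2, 3, 4 :: int} = {0..10} - {-1, 11}"
      by (simp add: FS_insert, rule set_eqI,
          simp only: Diff_iff atLeastAtMost_iff insert_iff empty_iff, presburger)
    ultimately show ?thesis using 5 by (simp add: hole_def)
  qed
next
  case (step k)
  let ?m = "if x \<le> 2 then x else -1"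
  let ?B = "{1..int k} - {x}"
  show ?case
  proof (cases "x = int k + 1")
    case True
    then have "{1..int (Suc k)} - {x} = ?B" by auto
    then show ?thesis using step by simp
  next
    case False
    then have eq: "{1..int (Suc k)} - {x} = insert (int k + 1) ?B" by auto
    have "int k + 1 + ?m \<le> \<Sum>?B \<and> int k + 1 + 2 * ?m \<noteq> \<Sum>?B"
    proof (cases "x \<le> 2")
      case True
      then have S: "\<Sum>?B = T k - x" using assms step by (simp add: sum_interval_minus)
      show ?thesis
      proof (cases "k = 4")
        case True
        have "T 4 = 10" using two_T[of 4] by simp
        moreover have "x = 1 \<or> x = 2" using \<open>x \<le> 2\<close> assms(1) by linarith
        ultimately show ?thesis using S True by auto
      next
        case False
        then have "int k * 3 \<le> T k" using step by (intro T_ge_mult) auto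
        then show ?thesis using S \<open>x \<le> 2\<close> assms(1) False step by auto
      qed
    next
      case False
      have "int k * 2 \<le> T k" using step by (intro T_ge_mult) auto
      then have "int k \<le> \<Sum>?B" using sum_interval_minus_ge[OF assms(1), of k] by linarith
      then show ?thesis using False by simp
    qed
    then show ?thesis
      unfolding eq using step assms(1) by (intro hole_insert) auto
  qed
qed

lemma primitive_superset:
  assumes "finite B" "B \<subseteq> {0<..}" "{1..int k} - {x} \<subseteq> B" "3 \<le> k"
  shows "primitive B"
proof -
  have "Gcd B dvd 1"
  proof (cases "x = 1")
    case True
    then have "2 \<in> B" "3 \<in> B" using assms(3,4) by auto
    then have "Gcd B dvd 3 - 2" by (intro dvd_diff) auto
    then show ?thesis by simp
  next
    case False
    then have "1 \<in> B" using assms(3,4) by auto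
    then show ?thesis by (rule Gcd_dvd)
  qed
  then show ?thesis using assms by (simp add: primitive_def)
qed

lemma dilate_insert [simp]: "dilate l (insert b B) = insert (l * of_int b) (dilate l B)"
  by (simp add: dilate_def)

lemma finite_dilate: "finite B \<Longrightarrow> finite (dilate l B)"
  by (simp add: dilate_def)

lemma inj_dilate: "l > 0 \<Longrightarrow> inj (\<lambda>b. l * of_int b :: real)"
  by (rule injI) simp

lemma dilate_inject: "l > 0 \<Longrightarrow> dilate l B = dilate l B' \<longleftrightarrow> B = B'"
  unfolding dilate_def by (rule inj_image_eq_iff[OF inj_dilate])

lemma card_dilate: "l > 0 \<Longrightarrow> card (dilate l B) = card B"
  unfolding dilate_def by (rule card_image[OF inj_on_subset[OF inj_dilate]]) auto

lemma FS_dilate: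
  assumes "l > 0" "finite B"
  shows "FS (dilate l B) = dilate l (FS B)"
  unfolding dilate_def
proof (rule FS_hom_image)
  show "inj_on (\<lambda>b. l * real_of_int b) B"
    using inj_on_subset[OF inj_dilate[OF assms(1)]] by blast
qed (use assms in \<open>auto simp: distrib_left\<close>)

lemma card_FS_dilate: "l > 0 \<Longrightarrow> finite B \<Longrightarrow> card (FS (dilate l B)) = card (FS B)"
  by (simp add: FS_dilate card_dilate)

lemma primitive_dilate_scale_unique:
  assumes l: "l > 0" "l' > 0" and B: "primitive B" "primitive B'" and eq: "dilate l B = dilate l' B'"
  shows "l = l'"
proof -
  have pos: "b > 0" if "b \<in> B \<union> B'" for b using that B by (auto simp: primitive_def)
  have "B \<noteq> {}" using B(1) by (auto simp: primitive_def)
  then obtain b0 where b0: "b0 \<in> B" by blast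
  then have "l * of_int b0 \<in> dilate l' B'" unfolding eq[symmetric] by (auto simp: dilate_def)
  then obtain b0' where b0': "b0' \<in> B'" "l * of_int b0 = l' * of_int b0'" by (auto simp: dilate_def)
  define g where "g = gcd b0' b0"
  have g: "g \<noteq> 0" using pos[of b0] b0 by (auto simp: g_def)
  obtain u v where uv: "b0' = u * g" "b0 = v * g" "coprime u v"
    using gcd_coprime_exists[OF g[unfolded g_def]] unfolding g_def by blast
  have luv: "l * of_int v = l' * of_int u"
    using b0'(2) g unfolding uv by simp
  have g_pos: "g > 0" using g unfolding g_def by (metis gcd_ge_0_int order_le_less)
  then have uv_pos: "u > 0" "v > 0" using pos[of b0] pos[of b0'] b0 b0' uv by (auto simp: zero_less_mult_iff)
  have ratio: "u * b = v * b'" if "l * of_int b = l' * of_int b'" for b b' :: int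
  proof -
    have "l * l' * of_int (u * b) = (l' * of_int u) * (l * of_int b)" by simp
    also have "\<dots> = l * l' * of_int (v * b')" unfolding luv[symmetric] that by simp
    finally show ?thesis using l by (simp only: mult_cancel_left of_int_eq_iff) simp
  qed
  have "v dvd Gcd B"
  proof (rule Gcd_greatest)
    fix b assume "b \<in> B"
    then have "l * of_int b \<in> dilate l' B'" unfolding eq[symmetric] by (auto simp: dilate_def)
    then obtain b' where "l * of_int b = l' * of_int b'" by (auto simp: dilate_def)
    then have "v dvd u * b" using ratio by (metis dvd_triv_left)
    then show "v dvd b" using uv(3) by (metis coprime_commute coprime_dvd_mult_right_iff)
  qed
  moreover have "u dvd Gcd B'"
  proof (rule Gcd_greatest)
    fix b' assume "b' \<in> B'"
    then have "l' * of_int b' \<in> dilate l B" unfolding eq by (auto simp: dilate_def)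
    then obtain b where "l' * of_int b' = l * of_int b" unfolding dilate_def by blast
    then have "u dvd v * b'" using ratio[of b b'] by (metis dvd_triv_left)
    then show "u dvd b'" using uv(3) by (simp add: coprime_dvd_mult_right_iff)
  qed
  ultimately have "u = 1" "v = 1" using B uv_pos by (auto simp: primitive_def)
  then show ?thesis using luv by simp
qed

lemma primitive_dilate_unique:
  assumes "l > 0" "l' > 0" "primitive B" "primitive B'" "dilate l B = dilate l' B'"
  shows "l = l' \<and> B = B'"
  using primitive_dilate_scale_unique[OF assms] assms dilate_inject by blast

lemma hole_extend:
  assumes l: "l > 0" and B: "hole m B" and m: "m \<in> {-1, 1, 2}"
    and b: "b \<notin> dilate l B" "b > 0" "l * of_int m < b"
  shows "(\<exists>c. b = l * of_int c \<and> hole m (insert c B)) \<or>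
    2 * card (FS B) \<le> card (FS (insert b (dilate l B))) + 5"
proof -
  let ?Z = "dilate l B"
  let ?F = "FS ?Z"
  have finB: "finite B" using B by (simp add: hole_def)
  then have fin: "finite ?Z" by (rule finite_dilate)
  have finF: "finite ?F" using fin by (rule finite_FS)
  have F: "?F = dilate l (FS B)" using l finB by (rule FS_dilate)
  have cF: "card ?F = card (FS B)" using l finB by (rule card_FS_dilate)
  have ins: "FS (insert b ?Z) = ?F \<union> (+) b ` ?F" using fin b(1) by (rule FS_insert)
  show ?thesis
  proof (cases "\<exists>c. b = l * of_int c")
    case False
    have "?F \<inter> (+) b ` ?F = {}"
    proof -
      have False if z: "b + w \<in> ?F" "w \<in> ?F" for w
      proof -
        obtain x y where "b + w = l * of_int x" "w = l * of_int y"
          using z unfolding F unfolding dilate_def by blast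
        then have "b = l * of_int (x - y)" by (simp add: algebra_simps)
        then show False using False by blast
      qed
      then show ?thesis by blast
    qed
    then have "card (FS (insert b ?Z)) = 2 * card ?F"
      unfolding ins using finF by (simp add: card_Un_disjoint card_image)
    then show ?thesis using cF by simp
  next
    case True
    then obtain c where c: "b = l * of_int c" by blast
    have cpos: "0 < c" "m < c" using b c l by (auto simp: zero_less_mult_iff)
    have cB: "c \<notin> B" using b(1) c by (auto simp: dilate_def)
    show ?thesis
    proof (cases "c + m \<le> \<Sum>B \<and> c + 2 * m \<noteq> \<Sum>B")
      case True
      then have "hole m (insert c B)" using B m cpos cB by (intro hole_insert) auto
      then show ?thesis using c by blast
    next
      case False
      then have c4: "\<Sum>B - c \<le> 4" using m by auto
      have FSB: "FS B \<subseteq> {0..\<Sum>B}" using B by (auto simp: hole_def)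
      have "card (FS B - {0..4}) \<ge> card (FS B) - card {0..4::int}"
        by (intro diff_card_le_card_Diff) simp
      then have "card (FS B) \<le> card ((+) c ` (FS B - {0..4})) + 5"
        by (simp add: card_image)
      moreover have "FS B \<inter> (+) c ` (FS B - {0..4}) = {}"
        using FSB c4 by force
      then have "card (FS B \<union> (+) c ` (FS B - {0..4})) = card (FS B) + card ((+) c ` (FS B - {0..4}))"
        using finite_FS[OF finB] by (simp add: card_Un_disjoint)
      moreover have "card (FS B \<union> (+) c ` (FS B - {0..4})) \<le> card (FS (insert c B))"
        unfolding FS_insert[OF finB cB] using finite_FS[OF finB] by (intro card_mono) auto
      moreover have "card (FS (insert b ?Z)) = card (FS (insert c B))"
        using card_FS_dilate[OF l, of "insert c B"] finB c by simp
      ultimately show ?thesis by linarith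
    qed
  qed
qed

section \<open>The sets \<open>\<E> n m p\<close>\<close>

lemma E_Nil: "\<E> n m [] = {1..int n + 1} - {m}"
  by (auto simp: \<E>_def)

lemma E_snoc: "\<E> (Suc n) m (p @ [t]) = insert (int n + 2 + t) (\<E> n m p)"
proof -
  let ?f = "\<lambda>n p r. int n - int (length p) + int r + 1 + p ! (r - 1)"
  have img: "{f r |r. 1 \<le> r \<and> r \<le> L} = f ` {1..L}" for f :: "nat \<Rightarrow> int" and L
    by auto
  have "{1..length (p @ [t])} = {1..length p} \<union> {Suc (length p)}" by auto
  then have "{?f (Suc n) (p @ [t]) r |r. 1 \<le> r \<and> r \<le> length (p @ [t])} =
      ?f (Suc n) (p @ [t]) ` ({1..length p} \<union> {Suc (length p)})"
    unfolding img by (rule arg_cong)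
  also have "\<dots> = insert (int n + 2 + t) (?f n p ` {1..length p})"
    by (force simp: nth_append)
  also have "?f n p ` {1..length p} = {?f n p r |r. 1 \<le> r \<and> r \<le> length p}"
    by (rule img[symmetric])
  finally have *: "{?f (Suc n) (p @ [t]) r |r. 1 \<le> r \<and> r \<le> length (p @ [t])} =
      insert (int n + 2 + t) {?f n p r |r. 1 \<le> r \<and> r \<le> length p}" .
  show ?thesis unfolding \<E>_def * by simp
qed

lemma finite_E: "finite (\<E> n m p)"
proof -
  have "finite ((\<lambda>r. int n - int (length p) + int r + 1 + p ! (r - 1)) ` {1..length p})" by simp
  also have "(\<lambda>r. int n - int (length p) + int r + 1 + p ! (r - 1)) ` {1..length p} =
      {int n - int (length p) + int r + 1 + p ! (r - 1) |r. 1 \<le> r \<and> r \<le> length p}" by auto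
  finally show ?thesis unfolding \<E>_def by simp
qed

lemma partitions_snoc:
  "p @ [t] \<in> partitions w \<longleftrightarrow> p \<in> partitions (w - t) \<and> 1 \<le> t \<and> (\<forall>x\<in>set p. x \<le> t)"
  by (auto simp: partitions_def sorted_append)

lemma length_partition: "p \<in> partitions w \<Longrightarrow> int (length p) \<le> w"
proof (induction p arbitrary: w rule: rev_induct)
  case Nil
  then show ?case by (simp add: partitions_def)
next
  case (snoc t p)
  then have "int (length p) \<le> w - t" "1 \<le> t" by (auto simp: partitions_snoc)
  then show ?case by simp
qed

lemma E_le:
  assumes "p \<in> partitions w" "x \<in> \<E> n m p" "\<And>y. y \<in> set p \<Longrightarrow> y \<le> t" "0 \<le> t"
  shows "x \<le> int n + 1 + t"
proof -
  have "p ! (r - 1) \<le> t" if "1 \<le> r" "r \<le> length p" for r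
    using that by (intro assms(3) nth_mem) simp
  then show ?thesis using assms(2,4) unfolding \<E>_def by force
qed

lemma partition_part_le: "p \<in> partitions w \<Longrightarrow> x \<in> set p \<Longrightarrow> x \<le> w"
proof (induction p arbitrary: w rule: rev_induct)
  case Nil
  then show ?case by simp
next
  case (snoc t p)
  then have p: "p \<in> partitions (w - t)" "1 \<le> t" by (auto simp: partitions_snoc)
  then have "0 \<le> w - t" using length_partition by fastforce
  moreover have "x \<le> w - t" if "x \<in> set p" using snoc.IH[OF p(1) that] .
  ultimately show ?case using snoc.prems(2) p(2) by force
qed

lemma E_pos:
  assumes "p \<in> partitions w" "length p \<le> n" "x \<in> \<E> n m p"
  shows "0 < x"
proof -
  have "p ! (r - 1) > 0" if "1 \<le> r" "r \<le> length p" for r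
  proof -
    have "p ! (r - 1) \<in> set p" using that by (intro nth_mem) simp
    then show ?thesis using assms(1) by (force simp: partitions_def)
  qed
  then show ?thesis using assms(2,3) unfolding \<E>_def by force
qed

lemma E_snoc_notin:
  assumes "p @ [t] \<in> partitions w"
  shows "int n + 2 + t \<notin> \<E> n m p"
  using E_le[of p "w - t" "int n + 2 + t" n m t] assms by (force simp: partitions_snoc)

lemma sum_E:
  assumes "p \<in> partitions w" "m \<in> {1, 2}" "m + int (length p) \<le> int n + 1"
  shows "\<Sum>(\<E> n m p) = T (n + 1) - m + w"
  using assms
proof (induction p arbitrary: n w rule: rev_induct)
  case Nil
  then have "w = 0" by (simp add: partitions_def)
  moreover have "{1..int n + 1} = {1..int (n + 1)}" by auto
  ultimately show ?case
    using Nil sum_interval_minus[of m "n + 1"] by (auto simp: E_Nil add.commute)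
next
  case (snoc t p)
  then obtain n' where n: "n = Suc n'" by (cases n) auto
  have "\<Sum>(\<E> n' m p) = T (n' + 1) - m + (w - t)"
    using snoc n by (intro snoc.IH) (auto simp: partitions_snoc)
  then show ?case
    using E_snoc_notin[OF snoc.prems(1), of n' m]
    by (simp add: n E_snoc finite_E T_Suc)
qed

lemma E_inject:
  assumes "p \<in> partitions w" "p' \<in> partitions w'" "length p \<le> n" "length p' \<le> n"
    and "m \<in> {1, 2}" "\<E> n m p = \<E> n m p'"
  shows "p = p'"
  using assms
proof (induction p arbitrary: n p' w w' rule: rev_induct)
  case Nil
  show ?case
  proof (cases p' rule: rev_cases)
    case (snoc q t)
    then obtain n' where n: "n = Suc n'" using Nil by (cases n) auto
    then have "int n' + 2 + t \<in> \<E> n m p'" by (simp add: snoc E_snoc)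
    then show ?thesis
      using Nil.prems(2) unfolding Nil.prems(6)[symmetric] by (auto simp: E_Nil n snoc partitions_snoc)
  qed simp
next
  case (snoc t p)
  obtain n' where n: "n = Suc n'" using snoc by (cases n) auto
  have mem: "int n' + 2 + t \<in> \<E> n m (p @ [t])" by (simp add: n E_snoc)
  show ?case
  proof (cases p' rule: rev_cases)
    case Nil
    then show ?thesis using mem snoc.prems by (auto simp: E_Nil n partitions_snoc)
  next
    case (snoc q s)
    have part: "p \<in> partitions (w - t)" "q \<in> partitions (w' - s)" "1 \<le> t" "1 \<le> s"
      "\<And>x. x \<in> set p \<Longrightarrow> x \<le> t" "\<And>x. x \<in> set q \<Longrightarrow> x \<le> s"
      using snoc.prems snoc by (auto simp: partitions_snoc)
    have eq: "insert (int n' + 2 + t) (\<E> n' m p) = insert (int n' + 2 + s) (\<E> n' m q)"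
      using snoc.prems snoc by (simp add: n E_snoc)
    have "s \<le> t"
    proof (rule ccontr)
      assume "\<not> s \<le> t"
      moreover have "int n' + 2 + s \<in> insert (int n' + 2 + t) (\<E> n' m p)" unfolding eq by simp
      ultimately have "int n' + 2 + s \<in> \<E> n' m p" by simp
      then show False using E_le[OF part(1) _ part(5), of "int n' + 2 + s" n' m] part(3) \<open>\<not> s \<le> t\<close> by simp
    qed
    moreover have "t \<le> s"
    proof (rule ccontr)
      assume "\<not> t \<le> s"
      moreover have "int n' + 2 + t \<in> insert (int n' + 2 + s) (\<E> n' m q)" unfolding eq[symmetric] by simp
      ultimately have "int n' + 2 + t \<in> \<E> n' m q" by simp
      then show False using E_le[OF part(2) _ part(6), of "int n' + 2 + t" n' m] part(4) \<open>\<not> t \<le> s\<close> by simp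
    qed
    ultimately have st: "s = t" by simp
    have "\<E> n' m p = \<E> n' m q"
      using eq E_snoc_notin[of p t w n' m] E_snoc_notin[of q s w' n' m] snoc.prems(1,2)
      unfolding snoc st by (metis insert_ident)
    then have "p = q" using snoc.prems snoc n by (intro snoc.IH[OF part(1,2)]) auto
    then show ?thesis using snoc st by simp
  qed
qed

lemma part_le_E:
  assumes "p \<in> partitions w" "length p \<le> n" "x \<in> set p"
  shows "\<exists>y\<in>\<E> n m p. int n + 1 + x \<le> y"
proof (cases p rule: rev_cases)
  case Nil
  then show ?thesis using assms by simp
next
  case (snoc q t)
  then obtain n' where n: "n = Suc n'" using assms by (cases n) auto
  have "x \<le> t" using assms snoc by (auto simp: partitions_snoc)
  then show ?thesis unfolding snoc n E_snoc by auto
qed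

lemma eq_E_if_hole:
  assumes "finite B" "B \<subseteq> {0<..}" "m \<notin> B" "m \<in> {1, 2}" "m = 2 \<Longrightarrow> 1 \<in> B" "card B = n"
  shows "\<exists>p w. p \<in> partitions w \<and> m + int (length p) \<le> int n + 1 \<and> B = \<E> n m p"
  using assms
proof (induction n arbitrary: B)
  case 0
  then have "B = {}" "m = 1" by auto
  then show ?case by (intro exI[of _ "[]"] exI[of _ 0]) (auto simp: E_Nil partitions_def)
next
  case (Suc n)
  define \<beta> where "\<beta> = Max B"
  have \<beta>: "\<beta> \<in> B" "\<And>x. x \<in> B \<Longrightarrow> x \<le> \<beta>"
    using Suc.prems by (auto simp: \<beta>_def intro!: Max_in)
  let ?I = "{1..int n + 2} - {m}"
  have cI: "card ?I = Suc n" using Suc.prems(4) by auto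
  show ?case
  proof (cases "\<beta> \<le> int n + 2")
    case True
    have "B \<subseteq> ?I"
    proof
      fix x assume "x \<in> B"
      then show "x \<in> ?I" using \<beta>(2)[of x] True Suc.prems(2,3) by force
    qed
    then have "B = ?I" using cI Suc.prems(6) by (intro card_subset_eq) auto
    then show ?thesis
      using Suc.prems(4) by (intro exI[of _ "[]"] exI[of _ 0]) (auto simp: E_Nil partitions_def)
  next
    case False
    define t where "t = \<beta> - int n - 2"
    have "\<exists>p w. p \<in> partitions w \<and> m + int (length p) \<le> int n + 1 \<and> B - {\<beta>} = \<E> n m p"
      using Suc.prems \<beta> False by (intro Suc.IH) auto
    then obtain p w where p: "p \<in> partitions w" "m + int (length p) \<le> int n + 1"
      and E: "B - {\<beta>} = \<E> n m p" by blast
    have "x \<le> t" if x: "x \<in> set p" for x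
    proof -
      obtain y where y: "y \<in> \<E> n m p" "int n + 1 + x \<le> y"
        using part_le_E[OF p(1) _ x, of n m] p(2) Suc.prems(4) by auto
      then have "y < \<beta>" using \<beta>(2)[of y] unfolding E[symmetric] by auto
      then show ?thesis using y(2) by (simp add: t_def)
    qed
    then have "p @ [t] \<in> partitions (w + t)"
      using p(1) False by (simp add: partitions_snoc t_def)
    moreover have "B = \<E> (Suc n) m (p @ [t])"
      using \<beta>(1) unfolding E_snoc E[symmetric] t_def by auto
    moreover have "m + int (length (p @ [t])) \<le> int (Suc n) + 1" using p(2) by simp
    ultimately show ?thesis by blast
  qed
qed

lemma hole_E:
  assumes p: "p \<in> partitions w" and m: "m \<in> {1, 2}"
    and q: "4 \<le> q" "int q = int n - int (length p) + 1"
    and bound: "int n + 1 + w + 3 * m < T q"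
  shows "hole m (\<E> n m p)"
proof -
  let ?B = "{1..int q} - {m}"
  let ?f = "\<lambda>r. int n - int (length p) + int r + 1 + p ! (r - 1)"
  let ?D = "{?f r |r. 1 \<le> r \<and> r \<le> length p}"
  have E: "\<E> n m p = ?B \<union> ?D" unfolding \<E>_def q(2) ..
  have "hole (if m \<le> 2 then m else -1) ?B"
    using m q by (intro hole_interval_minus) auto
  then have B: "hole m ?B" using m by auto
  have S: "\<Sum>?B = T q - m" using m q by (intro sum_interval_minus) auto
  have D: "int q < d \<and> d \<le> int n + 1 + w" if d: "d \<in> ?D" for d
  proof -
    obtain r where r: "1 \<le> r" "r \<le> length p" "d = ?f r" using d by blast
    then have mem: "p ! (r - 1) \<in> set p" by (intro nth_mem) simp
    then have "1 \<le> p ! (r - 1)" using p by (auto simp: partitions_def)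
    moreover have "p ! (r - 1) \<le> w" using partition_part_le[OF p mem] .
    ultimately show ?thesis using r q(2) by auto
  qed
  have "finite ?D" using finite_E[of n m p] unfolding E by blast
  moreover have "?D \<inter> ?B = {}" using D by force
  moreover have "0 < d \<and> m < d \<and> d + 2 * m < \<Sum>?B" if "d \<in> ?D" for d
    using D[OF that] m q(1) bound unfolding S by auto
  ultimately show ?thesis
    unfolding E using B m by (intro hole_union) auto
qed

lemma primitive_E:
  assumes "p \<in> partitions w" "4 \<le> q" "int q = int n - int (length p) + 1"
  shows "primitive (\<E> n m p)"
proof (rule primitive_superset[OF finite_E])
  have len: "length p \<le> n" using assms(2,3) by linarith
  show "\<E> n m p \<subseteq> {0<..}" using E_pos[OF assms(1) len] by auto
  show "{1..int q} - {m} \<subseteq> \<E> n m p" unfolding \<E>_def assms(3) by blast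
  show "3 \<le> q" using assms(2) by simp
qed

lemma hole_card_FS:
  assumes "hole m B"
  shows "m = -1 \<Longrightarrow> int (card (FS B)) = \<Sum>B + 1"
    and "0 < m \<Longrightarrow> 2 * m < \<Sum>B \<Longrightarrow> int (card (FS B)) = \<Sum>B - 1"
proof -
  have FS: "FS B = {0..\<Sum>B} - {m, \<Sum>B - m}" using assms by (simp add: hole_def)
  have S: "0 \<le> \<Sum>B" using assms by (intro sum_nonneg) (auto simp: hole_def)
  show "int (card (FS B)) = \<Sum>B + 1" if "m = -1"
  proof -
    have "FS B = {0..\<Sum>B}" using FS that by auto
    then show ?thesis using S by simp
  qed
  show "int (card (FS B)) = \<Sum>B - 1" if "0 < m" "2 * m < \<Sum>B"
  proof -
    have "{m, \<Sum>B - m} \<subseteq> {0..\<Sum>B}" "m \<noteq> \<Sum>B - m" using that by auto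
    then have "card (FS B) = card {0..\<Sum>B} - 2"
      unfolding FS by (subst card_Diff_subset) auto
    then show ?thesis using that by simp
  qed
qed

lemma hole_eq_hole:
  assumes "hole m B" "hole m' B" "0 < m" "0 < m'" "2 * m < \<Sum>B" "2 * m' < \<Sum>B"
  shows "m = m'"
proof -
  have "{0..\<Sum>B} - {m, \<Sum>B - m} = {0..\<Sum>B} - {m', \<Sum>B - m'}"
    using assms by (simp add: hole_def)
  moreover have "m \<in> {0..\<Sum>B}" "m' \<in> {0..\<Sum>B}" using assms by auto
  ultimately have "m \<in> {m', \<Sum>B - m'}" by blast
  then show ?thesis using assms by auto
qed

section \<open>Structure of sets with few subset sums\<close>

lemma card_FS_ge:
  fixes A :: "real set"
  assumes "finite A" "A \<subseteq> {0<..}"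
  shows "T (card A) + 1 \<le> int (card (FS A))"
  using assms
proof (induction A rule: finite_linorder_max_induct)
  case empty
  then show ?case by (simp add: T_def)
next
  case (insert b A)
  then have "card (FS A) + card A + 1 \<le> card (FS (insert b A))"
    by (intro new_sums_ge) auto
  moreover have "b \<notin> A" using insert by auto
  ultimately show ?case using insert by (simp add: T_Suc)
qed

lemma small_growth_segment:
  fixes A :: "real set"
  assumes "finite A" "A \<subseteq> {0<..}"
  shows "T (card A) + 2 * int (card A) - 2 * int p \<le> int (card (FS A)) \<or>
    (\<exists>X a. insert a X \<subseteq> A \<and> (\<forall>x\<in>X. x < a) \<and> (\<forall>y\<in>A - insert a X. a < y) \<and>
      p \<le> card X \<and> card (FS (insert a X)) \<le> card (FS X) + card X + 2)"
  using assms
proof (induction A rule: finite_linorder_max_induct)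
  case empty
  then show ?case by (simp add: T_def numeral_2_eq_2)
next
  case (insert b A)
  have b: "b \<notin> A" using insert by auto
  from insert have "T (card A) + 2 * int (card A) - 2 * int p \<le> int (card (FS A)) \<or>
    (\<exists>X a. insert a X \<subseteq> A \<and> (\<forall>x\<in>X. x < a) \<and> (\<forall>y\<in>A - insert a X. a < y) \<and>
      p \<le> card X \<and> card (FS (insert a X)) \<le> card (FS X) + card X + 2)" (is "?L \<or> ?R")
    by simp
  then show ?case
  proof
    assume ?R
    then obtain X a where Xa: "insert a X \<subseteq> A" "\<forall>x\<in>X. x < a" "\<forall>y\<in>A - insert a X. a < y"
      "p \<le> card X" "card (FS (insert a X)) \<le> card (FS X) + card X + 2" by blast
    moreover have "insert a X \<subseteq> insert b A" using Xa(1) by auto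
    moreover have "\<forall>y\<in>insert b A - insert a X. a < y" using Xa insert.hyps by auto
    ultimately show ?thesis by blast
  next
    assume L: ?L
    show ?thesis
    proof (cases "card A < p")
      case True
      then show ?thesis
        using card_FS_ge[of "insert b A"] insert b by simp
    next
      case pA: False
      show ?thesis
      proof (cases "card (FS (insert b A)) \<le> card (FS A) + card A + 2")
        case True
        then show ?thesis
          using pA insert.hyps by (intro disjI2 exI[of _ A] exI[of _ b]) auto
      next
        case False
        then show ?thesis using L b insert by (simp add: T_Suc)
      qed
    qed
  qed
qed

lemma small_FS_structure:
  fixes A :: "real set"
  assumes fin: "finite A" and pos: "A \<subseteq> {0<..}" and C: "-1 \<le> C"
    and n: "10 * C + 110 \<le> int (card A)"
    and small: "int (card (FS A)) \<le> T (card A) + int (card A) + C + 1"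
  obtains l B m k x where "l > 0" "A = dilate l B" "hole m B" "{1..int k} - {x} \<subseteq> B" "4 \<le> k"
    "m = -1 \<or> m \<in> {1, 2} \<and> x = m"
proof -
  define n where "n = card A"
  have n_ge: "10 * C + 110 \<le> int n" using n by (simp add: n_def)
  define p where "p = n div 3"
  have "3 * p \<le> n" "n \<le> 3 * p + 2" unfolding p_def by auto
  then have p: "3 * int p \<le> int n" "int n \<le> 3 * int p + 2" by linarith+
  have neg: "\<not> T (card A) + 2 * int (card A) - 2 * int p \<le> int (card (FS A))"
    using small p n_ge C unfolding n_def[symmetric] by linarith
  obtain X a where Xa: "insert a X \<subseteq> A" "\<forall>x\<in>X. x < a" "\<forall>y\<in>A - insert a X. a < y"
    "p \<le> card X" "card (FS (insert a X)) \<le> card (FS X) + card X + 2"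
    using mp[OF small_growth_segment[OF fin pos, of p, unfolded disj_imp] neg] by blast
  have finX: "finite X" using finite_subset[OF Xa(1) fin] by simp
  have a: "0 < a" "a \<notin> X" using Xa pos by auto
  have cX: "int (card X) \<ge> 30" using Xa(4) p n_ge C by linarith
  then have c11: "11 \<le> card X" by linarith
  have Xpos: "0 < x \<and> x < a" if "x \<in> X" for x using Xa pos that by auto
  obtain l B0 where lB: "l > 0" "B0 \<subseteq> {1..int (card X) + 2}" "insert a X = dilate l B0"
    by (rule small_growth_structure[OF finX Xpos a(1) c11 Xa(5)])
  define k where "k = card X + 2"
  have B0k: "B0 \<subseteq> {1..int k}" using lB(2) by (simp add: k_def add.commute)
  have k4: "4 \<le> k" using cX by (simp add: k_def)
  have "card B0 = card X + 1"
    using card_dilate[OF lB(1), of B0] finX a(2) unfolding lB(3)[symmetric] by simp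
  then have "card ({1..int k} - B0) = 1"
    using B0k by (simp add: card_Diff_subset finite_subset k_def)
  then obtain x where x: "{1..int k} - B0 = {x}" by (rule card_1_singletonE)
  then have B0: "B0 = {1..int k} - {x}" using B0k by blast
  have x1: "1 \<le> x" "x \<le> int k" using x by auto
  define m where "m = (if x \<le> 2 then x else -1)"
  have m: "m \<in> {-1, 1, 2}" using x1 by (auto simp: m_def)
  have hole0: "hole m B0"
    unfolding m_def B0 using x1 k4 by (intro hole_interval_minus) auto
  have la: "l * of_int m < a"
  proof -
    have "(if x = 3 then 4 else 3) \<in> B0" using k4 unfolding B0 by auto
    then obtain y where y: "y \<in> B0" "3 \<le> y" by (cases "x = 3") auto
    then have "l * of_int y \<in> insert a X" unfolding lB(3) by (auto simp: dilate_def)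
    then have "l * of_int y \<le> a" using Xa(2) by auto
    moreover have "l * of_int m < l * of_int y" using lB(1) m y by auto
    ultimately show ?thesis by simp
  qed
  define Q where "Q = int n + C + 1"
  have claim: "(\<exists>B. insert a X \<union> D = dilate l B \<and> B0 \<subseteq> B \<and> hole m B) \<or>
      T (card (insert a X \<union> D)) + Q < int (card (FS (insert a X \<union> D)))"
    if "finite D" "\<And>d. d \<in> D \<Longrightarrow> a < d" for D
    using that
  proof (induction D rule: finite_linorder_max_induct)
    case empty
    then show ?case using lB hole0 by auto
  next
    case (insert b D)
    let ?Z = "insert a X \<union> D"
    have Z: "finite ?Z" "?Z \<subseteq> {0<..}" "\<And>z. z \<in> ?Z \<Longrightarrow> z < b"
      using insert finX a Xpos by fastforce+
    have b: "a < b" "b \<notin> ?Z" "0 < b" using insert Z(3) a by force+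
    have cZ: "card (insert b ?Z) = Suc (card ?Z)" using Z(1) b(2) by simp
    have growth: "card (FS ?Z) + card ?Z + 1 \<le> card (FS (insert b ?Z))"
      using Z b(3) by (intro new_sums_ge) auto
    have IH: "(\<exists>B. ?Z = dilate l B \<and> B0 \<subseteq> B \<and> hole m B) \<or> T (card ?Z) + Q < int (card (FS ?Z))"
      using insert by simp
    have goal_eq: "insert a X \<union> insert b D = insert b ?Z" by auto
    show ?case unfolding goal_eq
    proof (cases "T (card ?Z) + Q < int (card (FS ?Z))")
      case True
      then show "(\<exists>B. insert b ?Z = dilate l B \<and> B0 \<subseteq> B \<and> hole m B) \<or>
          T (card (insert b ?Z)) + Q < int (card (FS (insert b ?Z)))"
        using growth unfolding cZ T_Suc by linarith
    next
      case False
      then obtain B where B: "?Z = dilate l B" "B0 \<subseteq> B" "hole m B" using IH by blast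
      have "(\<exists>c. b = l * of_int c \<and> hole m (insert c B)) \<or>
          2 * card (FS B) \<le> card (FS (insert b (dilate l B))) + 5"
        using lB(1) B(3) m b la unfolding B(1) by (intro hole_extend) auto
      then show "(\<exists>B. insert b ?Z = dilate l B \<and> B0 \<subseteq> B \<and> hole m B) \<or>
          T (card (insert b ?Z)) + Q < int (card (FS (insert b ?Z)))"
      proof
        assume "\<exists>c. b = l * of_int c \<and> hole m (insert c B)"
        then obtain c where c: "b = l * of_int c" "hole m (insert c B)" by blast
        have "insert b ?Z = dilate l (insert c B)" unfolding B(1) c(1) by simp
        then show ?thesis using c(2) B(2) by blast
      next
        assume le: "2 * card (FS B) \<le> card (FS (insert b (dilate l B))) + 5"
        have finB: "finite B" using B(3) by (simp add: hole_def)
        have "card (FS B) = card (FS ?Z)"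
          unfolding B(1) by (rule card_FS_dilate[OF lB(1) finB, symmetric])
        then have le': "2 * card (FS ?Z) \<le> card (FS (insert b ?Z)) + 5"
          using le unfolding B(1) by simp
        have "X \<subseteq> ?Z" "a \<in> ?Z" by auto
        then have "card X \<le> card ?Z" using Z(1) by (intro card_mono) auto
        then have Zn: "int n \<le> 3 * int (card ?Z) + 2" "30 \<le> int (card ?Z)"
          using Xa(4) p cX by linarith+
        then have "int (card ?Z) * 15 \<le> T (card ?Z)" by (intro T_ge_mult) auto
        then have "T (card ?Z) > int (card ?Z) + 4 + Q"
          using Zn n_ge C unfolding Q_def by linarith
        moreover have "T (card ?Z) + 1 \<le> int (card (FS ?Z))" using Z by (intro card_FS_ge) auto
        ultimately have "T (card (insert b ?Z)) + Q < int (card (FS (insert b ?Z)))"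
          using le' unfolding cZ T_Suc by linarith
        then show ?thesis by blast
      qed
    qed
  qed
  have "insert a X \<union> (A - insert a X) = A" using Xa(1) by blast
  then have "(\<exists>B. A = dilate l B \<and> B0 \<subseteq> B \<and> hole m B) \<or> T (card A) + Q < int (card (FS A))"
    using claim[of "A - insert a X"] fin Xa(3) by simp
  then obtain B where B: "A = dilate l B" "B0 \<subseteq> B" "hole m B"
    using small unfolding Q_def n_def by auto
  show thesis
  proof (rule that[OF lB(1) B(1,3) _ k4])
    show "{1..int k} - {x} \<subseteq> B" using B(2) B0 by simp
    show "m = -1 \<or> m \<in> {1, 2} \<and> x = m" using x1 by (auto simp: m_def)
  qed
qed

lemma E_facts:
  assumes C: "-1 \<le> C" and n: "10 * C + 110 \<le> int n" and m: "m \<in> {1, 2}"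
    and p: "p \<in> partitions w" and w: "w \<le> C + 3"
  shows "hole m (\<E> n m p)" "\<Sum>(\<E> n m p) = T (n + 1) - m + w" "primitive (\<E> n m p)"
    "length p \<le> n" "2 * m < \<Sum>(\<E> n m p)"
proof -
  have len: "int (length p) \<le> w" using p by (rule length_partition)
  then have "int (length p) \<le> int n" using w n C by linarith
  then show len_n: "length p \<le> n" by simp
  define q where "q = n - length p + 1"
  have q: "int q = int n - int (length p) + 1" using len_n by (simp add: q_def)
  have q_ge: "int q \<ge> int n - C - 2" using q len w by linarith
  then have "int q * 10 \<le> T q" using n C by (intro T_ge_mult) auto
  then have "int n + 1 + w + 3 * m < T q" using q_ge n C w m by auto
  then show "hole m (\<E> n m p)" using q q_ge n C by (intro hole_E[OF p m _ q]) auto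
  show "primitive (\<E> n m p)" using q q_ge n C by (intro primitive_E[OF p _ q]) auto
  show S: "\<Sum>(\<E> n m p) = T (n + 1) - m + w"
    using p m len w n C by (intro sum_E) auto
  have "int (n + 1) * 1 \<le> T (n + 1)" using n C by (intro T_ge_mult) auto
  then show "2 * m < \<Sum>(\<E> n m p)" unfolding S using m n C len by auto
qed

lemma recursive_add_const: "recursive k f \<Longrightarrow> recursive k (\<lambda>xs. f xs + c)"
proof (induction c)
  case (Suc c)
  then have "recursive k (\<lambda>xs. (\<lambda>ys. Suc (ys ! 0)) (map (\<lambda>f. f xs) [\<lambda>xs. f xs + c]))"
    using recursive.succ by (intro recursive.comp) auto
  then show ?case by simp
qed simp

lemma computable_affine: "computable (\<lambda>x. a * x + b)"
proof -
  have "recursive 0 (\<lambda>_. 0 + b)" "recursive (0 + 2) (\<lambda>xs. xs ! 1 + a)"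
    by (intro recursive_add_const recursive.zero recursive.proj; simp)+
  then have "recursive (0 + 1) (\<lambda>xs. rec_nat ((\<lambda>_. 0 + b) (tl xs))
      (\<lambda>i acc. (\<lambda>xs. xs ! 1 + a) (i # acc # tl xs)) (hd xs))"
    by (rule recursive.prec)
  moreover have "rec_nat b (\<lambda>_ acc. acc + a) x = a * x + b" for x
    by (induction x) auto
  ultimately show ?thesis
    unfolding computable_def by (intro exI conjI) auto
qed

lemma card_FS_le_sum:
  fixes B :: "int set"
  assumes "finite B" "B \<subseteq> {0<..}"
  shows "int (card (FS B)) \<le> \<Sum>B + 1"
proof -
  have S: "0 \<le> \<Sum>B" using assms by (intro sum_nonneg) auto
  have "FS B \<subseteq> {0..\<Sum>B}"
  proof
    fix s assume "s \<in> FS B"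
    then obtain X where X: "X \<subseteq> B" "s = \<Sum>X" by (rule FS_E)
    have "0 \<le> \<Sum>X" using X(1) assms(2) by (intro sum_nonneg) auto
    moreover have "\<Sum>X \<le> \<Sum>B" using assms X(1) by (intro sum_mono2) auto
    ultimately show "s \<in> {0..\<Sum>B}" using X(2) by simp
  qed
  then have "card (FS B) \<le> card {0..\<Sum>B}" by (intro card_mono) auto
  then show ?thesis using S by simp
qed

lemma dichotomy:
  fixes A :: "real set"
  assumes C: "-1 \<le> C" and n: "10 * C + 110 \<le> int n"
    and A: "finite A" "card A = n" "A \<subseteq> {0<..}"
    and small: "int (card (FS A)) \<le> T n + int n + C + 1"
  shows "(\<exists>l B. l > 0 \<and> primitive B \<and> A = dilate l B \<and> \<Sum>B \<le> T n + int n + C) \<or>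
    (\<exists>l m p. l > 0 \<and> m \<in> {1, 2} \<and> p \<in> partitions (C + m) \<union> partitions (C + m + 1) \<and>
       A = dilate l (\<E> n m p))"
proof -
  obtain l B m k x where B: "l > 0" "A = dilate l B" "hole m B" "{1..int k} - {x} \<subseteq> B" "4 \<le> k"
    and m: "m = -1 \<or> m \<in> {1, 2} \<and> x = m"
    using small_FS_structure[OF A(1,3) C] n small unfolding A(2) by blast
  have finB: "finite B" "B \<subseteq> {0<..}" using B(3) by (auto simp: hole_def)
  have prim: "primitive B" using finB B(4,5) by (intro primitive_superset) auto
  have cF: "card (FS A) = card (FS B)" using B(1) finB(1) unfolding B(2) by (rule card_FS_dilate)
  have cB: "card B = n" using card_dilate[OF B(1), of B] A(2) B(2) by simp
  have "T n + 1 \<le> int (card (FS B))" using card_FS_ge[OF A(1,3)] A(2) cF by simp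
  moreover have "int n * 1 \<le> T n" using n C by (intro T_ge_mult) auto
  ultimately have big: "100 \<le> \<Sum>B" using card_FS_le_sum[OF finB] n C by linarith
  show ?thesis
  proof (cases "\<Sum>B \<le> T n + int n + C")
    case True
    then show ?thesis using B(1,2) prim by blast
  next
    case False
    then have "m \<noteq> -1" using hole_card_FS(1)[OF B(3)] small cF by auto
    then have m: "m \<in> {1, 2}" "x = m" using m by auto
    have "int (card (FS B)) = \<Sum>B - 1"
      using m(1) big by (intro hole_card_FS(2)[OF B(3)]) auto
    then have SB: "\<Sum>B = T n + int n + C + 1 \<or> \<Sum>B = T n + int n + C + 2"
      using small cF False by linarith
    have "m \<notin> FS B" using B(3) by (auto simp: hole_def)
    then have mB: "m \<notin> B" using subset_FS by blast
    have "1 \<in> B" if "m = 2" using B(4,5) m that by auto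
    then obtain p w where p: "p \<in> partitions w" "m + int (length p) \<le> int n + 1" "B = \<E> n m p"
      using eq_E_if_hole[OF finB mB m(1) _ cB] by blast
    have "\<Sum>B = T (n + 1) - m + w" unfolding p(3) by (rule sum_E[OF p(1) m(1) p(2)])
    then have "w = C + m \<or> w = C + m + 1" using SB by (auto simp: T_Suc)
    then have "p \<in> partitions (C + m) \<union> partitions (C + m + 1)" using p(1) by auto
    then show ?thesis using B(1,2) m(1) p(3) by blast
  qed
qed

lemma E_unique:
  assumes C: "-1 \<le> C" and n: "10 * C + 110 \<le> int n"
    and m: "m \<in> {1, 2}" "m' \<in> {1, 2}"
    and p: "p \<in> partitions w" "w \<le> C + 3" "p' \<in> partitions w'" "w' \<le> C + 3"
    and l: "l > 0" "l' > 0" and eq: "dilate l (\<E> n m p) = dilate l' (\<E> n m' p')"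
  shows "l = l' \<and> m = m' \<and> p = p'"
proof -
  note E = E_facts[OF C n m(1) p(1,2)] and E' = E_facts[OF C n m(2) p(3,4)]
  have lE: "l = l'" "\<E> n m p = \<E> n m' p'"
    using primitive_dilate_unique[OF l E(3) E'(3) eq] by auto
  have "m = m'"
    using m by (intro hole_eq_hole[OF E(1) E'(1)[folded lE(2)] _ _ E(5) E'(5)[folded lE(2)]]) auto
  moreover from this have "p = p'"
    using lE(2) by (intro E_inject[OF p(1,3) E(4) E'(4) m(1)]) simp
  ultimately show ?thesis using lE by simp
qed

lemma characterisation:
  fixes A :: "real set"
  assumes C: "-1 \<le> C" and n: "10 * C + 110 \<le> int n"
    and A: "finite A" "card A = n" "A \<subseteq> {0<..}"
  shows "int (card (FS A)) \<le> T n + int n + C + 1 \<longleftrightarrow>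
           ((\<exists>!(l, B). l > 0 \<and> primitive B \<and> A = dilate l B \<and> \<Sum>B \<le> T n + int n + C)
            \<noteq>
            (\<exists>!(l, m, p). l > 0 \<and> m \<in> {1, 2} \<and>
               p \<in> partitions (C + m) \<union> partitions (C + m + 1) \<and>
               A = dilate l (\<E> n m p)))"
proof -
  define P where "P l B \<longleftrightarrow> l > 0 \<and> primitive B \<and> A = dilate l B \<and> \<Sum>B \<le> T n + int n + C" for l B
  define R where "R l m p \<longleftrightarrow> l > 0 \<and> m \<in> {1, 2} \<and>
    p \<in> partitions (C + m) \<union> partitions (C + m + 1) \<and> A = dilate l (\<E> n m p)" for l m p
  have R: "\<exists>w. p \<in> partitions w \<and> w \<le> C + 3 \<and> C + m \<le> w \<and> w \<le> C + m + 1" if "R l m p" for l m p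
  proof -
    have "p \<in> partitions (C + m) \<or> p \<in> partitions (C + m + 1)" "m \<le> 2"
      using that by (auto simp: R_def)
    then show ?thesis
      by (elim disjE) (rule exI[of _ "C + m"], simp, rule exI[of _ "C + m + 1"], simp)
  qed
  have P1: "(\<exists>!(l, B). P l B) \<longleftrightarrow> (\<exists>l B. P l B)"
  proof
    assume "\<exists>!(l, B). P l B"
    then show "\<exists>l B. P l B" by (auto dest: ex1_implies_ex)
  next
    assume "\<exists>l B. P l B"
    then obtain l B where "P l B" by blast
    have uniq: "l' = l \<and> B' = B" if "P l' B'" for l' B'
      using that \<open>P l B\<close> primitive_dilate_unique[of l' l B' B] unfolding P_def by metis
    show "\<exists>!(l, B). P l B"
    proof (rule ex1I[of _ "(l, B)"])
      show "case (l, B) of (l, B) \<Rightarrow> P l B" using \<open>P l B\<close> by simp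
      show "y = (l, B)" if "case y of (l, B) \<Rightarrow> P l B" for y
        using that by (cases y) (auto dest: uniq)
    qed
  qed
  have R1: "(\<exists>!(l, m, p). R l m p) \<longleftrightarrow> (\<exists>l m p. R l m p)"
  proof
    assume "\<exists>!(l, m, p). R l m p"
    then show "\<exists>l m p. R l m p" by (auto dest: ex1_implies_ex)
  next
    assume "\<exists>l m p. R l m p"
    then obtain l m p where r: "R l m p" by blast
    have uniq: "l' = l \<and> m' = m \<and> p' = p" if r': "R l' m' p'" for l' m' p'
    proof -
      obtain w w' where "p \<in> partitions w" "w \<le> C + 3" "p' \<in> partitions w'" "w' \<le> C + 3"
        using R[OF r] R[OF r'] by blast
      then show ?thesis
        using E_unique[OF C n, of m' m p' w' p w l' l] r r' unfolding R_def by metis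
    qed
    show "\<exists>!(l, m, p). R l m p"
    proof (rule ex1I[of _ "(l, m, p)"])
      show "case (l, m, p) of (l, m, p) \<Rightarrow> R l m p" using r by simp
      show "y = (l, m, p)" if "case y of (l, m, p) \<Rightarrow> R l m p" for y
        using that by (cases y) (auto dest: uniq)
    qed
  qed
  have not_both: "\<not> (P l B \<and> R l' m p)" for l B l' m p
  proof
    assume *: "P l B \<and> R l' m p"
    then obtain w where w: "p \<in> partitions w" "w \<le> C + 3" "C + m \<le> w" using R by blast
    have m: "m \<in> {1, 2}" using * by (simp add: R_def)
    note E = E_facts[OF C n m w(1,2)]
    have "B = \<E> n m p"
      using * E(3) primitive_dilate_unique[of l l' B "\<E> n m p"] unfolding P_def R_def by metis
    then have "T (n + 1) - m + w \<le> T n + int n + C" using * E(2) by (simp add: P_def)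
    then show False using w(3) by (simp add: T_Suc)
  qed
  have "int (card (FS A)) \<le> T n + int n + C + 1" if "P l B" for l B
  proof -
    have "finite B" "B \<subseteq> {0<..}" using that by (auto simp: P_def primitive_def)
    then show ?thesis
      using card_FS_le_sum[of B] card_FS_dilate[of l B] that by (simp add: P_def)
  qed
  moreover have "int (card (FS A)) \<le> T n + int n + C + 1" if r: "R l m p" for l m p
  proof -
    obtain w where w: "p \<in> partitions w" "w \<le> C + 3" "w \<le> C + m + 1" using R[OF r] by blast
    have m: "m \<in> {1, 2}" using r by (simp add: R_def)
    note E = E_facts[OF C n m w(1,2)]
    have "int (card (FS (\<E> n m p))) = \<Sum>(\<E> n m p) - 1"
      using m by (intro hole_card_FS(2)[OF E(1) _ E(5)]) auto
    moreover have "card (FS A) = card (FS (\<E> n m p))"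
      using r finite_E card_FS_dilate by (simp add: R_def)
    ultimately show ?thesis using w(3) E(2) by (simp add: T_Suc)
  qed
  moreover have "(\<exists>l B. P l B) \<or> (\<exists>l m p. R l m p)"
    if "int (card (FS A)) \<le> T n + int n + C + 1"
    using dichotomy[OF C n A that] unfolding P_def R_def .
  ultimately have "int (card (FS A)) \<le> T n + int n + C + 1 \<longleftrightarrow>
      ((\<exists>l B. P l B) \<noteq> (\<exists>l m p. R l m p))"
    using not_both by blast
  then show ?thesis unfolding P1[symmetric] R1[symmetric] unfolding P_def R_def .
qed

theorem theorem1p1:
  "\<exists>N :: nat \<Rightarrow> nat. computable N \<and>
    (\<forall>C::int. C \<ge> -1 \<longrightarrow> (\<forall>n \<ge> N (nat (C + 1)).
      (\<forall>A :: real set. finite A \<and> card A = n \<and> A \<subseteq> {0<..} \<longrightarrow>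
         (int (card (FS A)) \<le> T n + int n + C + 1 \<longleftrightarrow>
           ((\<exists>!(l, B). l > 0 \<and> primitive B \<and> A = dilate l B \<and> \<Sum>B \<le> T n + int n + C)
            \<noteq>
            (\<exists>!(l, m, p). l > 0 \<and> m \<in> {1, 2} \<and>
               p \<in> partitions (C + m) \<union> partitions (C + m + 1) \<and>
               A = dilate l (\<E> n m p)))))
      \<and>
      (\<forall>m \<in> {1, 2}. \<forall>p \<in> partitions (C + m) \<union> partitions (C + m + 1).
         let w = sum_list p; L = \<Sum>(\<E> n m p) in
           L = T (n + 1) - m + w \<and>
           FS (\<E> n m p) = {0..L} - {m, L - m})))"
proof (intro exI[of _ "\<lambda>c. 10 * c + 100"] conjI computable_affine allI impI ballI)
  fix C :: int and n :: nat
  assume C: "-1 \<le> C" and "10 * nat (C + 1) + 100 \<le> n"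
  then have n: "10 * C + 110 \<le> int n" by linarith
  show "int (card (FS A)) \<le> T n + int n + C + 1 \<longleftrightarrow>
      ((\<exists>!(l, B). l > 0 \<and> primitive B \<and> A = dilate l B \<and> \<Sum>B \<le> T n + int n + C)
       \<noteq>
       (\<exists>!(l, m, p). l > 0 \<and> m \<in> {1, 2} \<and>
          p \<in> partitions (C + m) \<union> partitions (C + m + 1) \<and> A = dilate l (\<E> n m p)))"
    if "finite A \<and> card A = n \<and> A \<subseteq> {0<..}" for A :: "real set"
    using that by (intro characterisation[OF C n]) auto
  fix m p assume m: "m \<in> {1, 2 :: int}" and "p \<in> partitions (C + m) \<union> partitions (C + m + 1)"
  then have w: "p \<in> partitions (sum_list p)" "sum_list p \<le> C + 3"
    by (auto simp: partitions_def)
  note E = E_facts[OF C n m w]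
  show "let w = sum_list p; L = \<Sum>(\<E> n m p) in
      L = T (n + 1) - m + w \<and> FS (\<E> n m p) = {0..L} - {m, L - m}"
    using E(1,2) unfolding Let_def hole_def by blast
qed

end
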